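(* For each $t\in[0,1)$ the spectra of the bounded operators $C_t\colon H^\infty\to H^\infty$ and $C_t\colon A(\mathbb{D})\to A(\mathbb{D})$ are given by $$\sigma_{pt}(C_t;H^\infty)=\sigma_{pt}(C_t;A(\mathbb{D}))=\left\{\frac{1}{m+1}: m\in\mathbb{N}_0\right\}$$ and $$\sigma(C_t;H^\infty)=\sigma(C_t;A(\mathbb{D}))=\left\{\frac{1}{m+1}: m\in\mathbb{N}_0\right\}\cup\{0\}.$$
   Context: Let $\mathbb{N}_0=\{0,1,2,\ldots\}$, $\mathbb{D}=\{z\in\mathbb{C}:|z|<1\}$ and let $H(\mathbb{D})$ be the space of holomorphic functions on $\mathbb{D}$. $H^\infty$ is the Banach space of bounded $f\in H(\mathbb{D})$ with the norm $\|f\|_\infty=\sup_{z\in\mathbb{D}}|f(z)|$. The disc algebra $A(\mathbb{D})$ is its closed subspace of all $f\in H(\mathbb{D})$ that extend to a continuous function on $\overline{\mathbb{D}}$. For $t\in[0,1)$ the generalized Cesàro operator $C_t\colon H(\mathbb{D})\to H(\mathbb{D})$ is defined by $(C_tf)(0):=f(0)$ and $(C_tf)(z):=\frac1z\int_0^z\frac{f(\xi)}{1-t\xi}\,d\xi$ for $z\in\mathbb{D}\setminus\{0\}$; it acts continuously on $H^\infty$ and on $A(\mathbb{D})$. For a bounded linear operator $T$ on a complex Banach space $X$, $\sigma(T;X)$ is the set of $\lambda\in\mathbb{C}$ such that $\lambda I-T$ has no bounded inverse on $X$, and $\sigma_{pt}(T;X)$ (the point spectrum) is the set of $\lambda\in\mathbb{C}$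 such that $\lambda I-T$ is not injective. *)

theory Defs
  imports "HOL-Complex_Analysis.Complex_Analysis"
begin

abbreviation unit_disc :: "complex set" ("\<D>")
  where "\<D> \<equiv> ball 0 1"

text \<open>
  A holomorphic function on the disc is represented by a total function that vanishes outside the
  disc. With this normalisation two elements are equal as HOL functions iff they agree on the disc,
  so injectivity and inverses of operators below have their usual meaning.
\<close>

definition hol_disc :: "(complex \<Rightarrow> complex) set"
  where "hol_disc = {f. f holomorphic_on \<D> \<and> (\<forall>z. z \<notin> \<D> \<longrightarrow> f z = 0)}"

definition Hinf :: "(complex \<Rightarrow> complex) set"
  where "Hinf = {f \<in> hol_disc. bounded (f ` \<D>)}"

text \<open>
  The boundary values of an element of the disc algebra are not those of the representing function
  (which are 0 by the normalisation) but those of the continuous extension \<open>g\<close>.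
\<close>

definition disc_algebra :: "(complex \<Rightarrow> complex) set"
  where "disc_algebra =
    {f \<in> hol_disc. \<exists>g. continuous_on (closure \<D>) g \<and> (\<forall>z\<in>\<D>. g z = f z)}"

definition norm_inf :: "(complex \<Rightarrow> complex) \<Rightarrow> real"
  where "norm_inf f = (SUP z\<in>\<D>. norm (f z))"

definition Cesaro :: "real \<Rightarrow> (complex \<Rightarrow> complex) \<Rightarrow> (complex \<Rightarrow> complex)"
  where "Cesaro t f z =
    (if z \<notin> \<D> then 0
     else if z = 0 then f 0
     else (1 / z) * contour_integral (linepath 0 z) (\<lambda>\<xi>. f \<xi> / (1 - complex_of_real t * \<xi>)))"

text \<open>
  In the following, \<open>X\<close> is a complex linear space of functions with pointwise operations, normed by
  \<^const>\<open>norm_inf\<close>. Operators are only considered through their values on \<open>X\<close>.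
\<close>

definition bounded_operator_on ::
    "(complex \<Rightarrow> complex) set \<Rightarrow> ((complex \<Rightarrow> complex) \<Rightarrow> (complex \<Rightarrow> complex)) \<Rightarrow> bool"
  where "bounded_operator_on X T \<longleftrightarrow>
    (\<forall>f\<in>X. T f \<in> X) \<and>
    (\<forall>f\<in>X. \<forall>g\<in>X. \<forall>a b. T (\<lambda>z. a * f z + b * g z) = (\<lambda>z. a * T f z + b * T g z)) \<and>
    (\<exists>K. \<forall>f\<in>X. norm_inf (T f) \<le> K * norm_inf f)"

definition shifted ::
    "complex \<Rightarrow> ((complex \<Rightarrow> complex) \<Rightarrow> (complex \<Rightarrow> complex)) \<Rightarrow> (complex \<Rightarrow> complex) \<Rightarrow> (complex \<Rightarrow> complex)"
  where "shifted l T f = (\<lambda>z. l * f z - T f z)"  \<comment> \<open>\<open>(l I - T) f\<close>\<close>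

definition spectrum_on ::
    "(complex \<Rightarrow> complex) set \<Rightarrow> ((complex \<Rightarrow> complex) \<Rightarrow> (complex \<Rightarrow> complex)) \<Rightarrow> complex set"
  where "spectrum_on X T =
    {l. \<not> (\<exists>S. bounded_operator_on X S \<and>
              (\<forall>f\<in>X. S (shifted l T f) = f) \<and> (\<forall>f\<in>X. shifted l T (S f) = f))}"

definition point_spectrum_on ::
    "(complex \<Rightarrow> complex) set \<Rightarrow> ((complex \<Rightarrow> complex) \<Rightarrow> (complex \<Rightarrow> complex)) \<Rightarrow> complex set"
  where "point_spectrum_on X T = {l. \<not> inj_on (shifted l T) X}"


text \<open>The generalized Cesaro operators are bounded operators on both spaces.\<close>

lemma one_minus_mult_bound:
  assumes "0 \<le> t" "t < 1" "z \<in> \<D>"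
  shows "1 - t \<le> norm (1 - complex_of_real t * z)"
proof -
  have "norm (complex_of_real t * z) \<le> t"
    using assms by (simp add: norm_mult mult_left_le)
  moreover have "1 - norm (complex_of_real t * z) \<le> norm (1 - complex_of_real t * z)"
    using norm_triangle_ineq2[of 1 "complex_of_real t * z"] by simp
  ultimately show ?thesis by simp
qed

lemma holomorphic_Cesaro_integrand:
  assumes "0 \<le> t" "t < 1" "f holomorphic_on \<D>"
  shows "(\<lambda>\<xi>. f \<xi> / (1 - complex_of_real t * \<xi>)) holomorphic_on \<D>"
proof -
  have "1 - complex_of_real t * z \<noteq> 0" if "z \<in> \<D>" for z
    using one_minus_mult_bound[OF assms(1,2) that] assms by auto
  then show ?thesis
    by (intro holomorphic_intros assms) auto
qed

lemma Cesaro_primitive: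
  assumes "0 \<le> t" "t < 1" "f \<in> hol_disc"
  obtains G where "G 0 = 0"
    and "\<And>z. z \<in> \<D> \<Longrightarrow> (G has_field_derivative f z / (1 - complex_of_real t * z)) (at z)"
    and "\<And>z. z \<in> \<D> \<Longrightarrow> Cesaro t f z = (if z = 0 then f 0 else G z / z)"
proof -
  let ?g = "\<lambda>\<xi>. f \<xi> / (1 - complex_of_real t * \<xi>)"
  have "f holomorphic_on \<D>" using assms by (simp add: hol_disc_def)
  then have hol: "?g holomorphic_on \<D>"
    using assms holomorphic_Cesaro_integrand by blast
  obtain F where F: "\<And>z. z \<in> \<D> \<Longrightarrow> (F has_field_derivative ?g z) (at z within \<D>)"
    using holomorphic_convex_primitive'[OF convex_ball open_ball hol] by blast
  have int: "contour_integral (linepath 0 z) ?g = F z - F 0" if "z \<in> \<D>" for z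
  proof -
    have "closed_segment 0 z \<subseteq> \<D>"
      using that by (intro closed_segment_subset) auto
    then show ?thesis
      using contour_integral_primitive[of \<D> F ?g "linepath 0 z"] F
      by (auto intro: contour_integral_unique)
  qed
  show ?thesis
  proof (rule that[of "\<lambda>z. F z - F 0"])
    fix z assume z: "z \<in> \<D>"
    then have "(F has_field_derivative ?g z) (at z)"
      using F[OF z] by (simp add: at_within_open[OF z])
    then show "((\<lambda>z. F z - F 0) has_field_derivative ?g z) (at z)"
      by (auto intro!: derivative_eq_intros)
    show "Cesaro t f z = (if z = 0 then f 0 else (F z - F 0) / z)"
      using z int[OF z] by (simp add: Cesaro_def)
  qed simp
qed

lemma norm_le_norm_inf:
  assumes "f \<in> Hinf" "z \<in> \<D>"
  shows "norm (f z) \<le> norm_inf f"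
proof -
  have "bounded (f ` \<D>)" using assms(1) by (simp only: Hinf_def mem_Collect_eq)
  then obtain B where B: "\<And>z. z \<in> \<D> \<Longrightarrow> norm (f z) \<le> B"
    unfolding bounded_iff by (meson imageI)
  show ?thesis
    unfolding norm_inf_def
    by (rule cSUP_upper[OF assms(2)]) (rule bdd_aboveI2[OF B])
qed

lemma norm_inf_nonneg:
  assumes "f \<in> Hinf"
  shows "0 \<le> norm_inf f"
  by (rule order_trans[OF norm_ge_zero norm_le_norm_inf[OF assms, of 0]]) simp

lemma Cesaro_integrand_bound:
  assumes t: "0 \<le> t" "t < 1" and f: "f \<in> Hinf" and z: "z \<in> \<D>"
  shows "norm (f z / (1 - complex_of_real t * z)) \<le> norm_inf f / (1 - t)"
  unfolding norm_divide
proof (rule frac_le)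
  show "norm (f z) \<le> norm_inf f" by (rule norm_le_norm_inf[OF f z])
  show "1 - t \<le> norm (1 - complex_of_real t * z)" by (rule one_minus_mult_bound[OF t z])
qed (use t norm_inf_nonneg[OF f] in auto)

lemma disc_algebra_subset_Hinf: "disc_algebra \<subseteq> Hinf"
proof
  fix f assume "f \<in> disc_algebra"
  then obtain g where f: "f \<in> hol_disc" and g: "continuous_on (closure \<D>) g"
    and eq: "\<And>z. z \<in> \<D> \<Longrightarrow> g z = f z"
    by (auto simp: disc_algebra_def)
  have "bounded (g ` closure \<D>)"
    using g by (intro compact_imp_bounded compact_continuous_image) auto
  then have "bounded (g ` \<D>)"
    by (rule bounded_subset) (use closure_subset in blast)
  moreover have "g ` \<D> = f ` \<D>" using eq by (intro image_cong) auto
  ultimately show "f \<in> Hinf" using f by (simp add: Hinf_def)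
qed

lemma Cesaro_hol_disc:
  assumes "0 \<le> t" "t < 1" "f \<in> hol_disc"
  shows "Cesaro t f \<in> hol_disc"
proof -
  obtain G where G: "G 0 = 0"
    "\<And>z. z \<in> \<D> \<Longrightarrow> (G has_field_derivative f z / (1 - complex_of_real t * z)) (at z)"
    "\<And>z. z \<in> \<D> \<Longrightarrow> Cesaro t f z = (if z = 0 then f 0 else G z / z)"
    using Cesaro_primitive[OF assms] by blast
  have "G holomorphic_on \<D>"
    unfolding holomorphic_on_open[OF open_ball] by (meson G(2))
  moreover have "deriv G 0 = f 0"
    using DERIV_imp_deriv[OF G(2)[of 0]] by simp
  moreover have "G z = (z - 0) * Cesaro t f z" if "z \<in> \<D> - {0}" for z
    using that G(3)[of z] by simp
  moreover have "Cesaro t f 0 = f 0"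
    using G(3)[of 0] by simp
  ultimately have "Cesaro t f holomorphic_on \<D>"
    using G(1) pole_theorem_open_0[of G \<D> 0 "Cesaro t f"] by simp
  then show ?thesis by (simp add: hol_disc_def Cesaro_def)
qed

lemma Cesaro_bound:
  assumes t: "0 \<le> t" "t < 1" and f: "f \<in> Hinf" and z: "z \<in> \<D>"
  shows "norm (Cesaro t f z) \<le> 1 / (1 - t) * norm_inf f"
proof -
  have fh: "f \<in> hol_disc" using f by (simp add: Hinf_def)
  obtain G where G: "G 0 = 0"
    "\<And>z. z \<in> \<D> \<Longrightarrow> (G has_field_derivative f z / (1 - complex_of_real t * z)) (at z)"
    "\<And>z. z \<in> \<D> \<Longrightarrow> Cesaro t f z = (if z = 0 then f 0 else G z / z)"
    using Cesaro_primitive[OF t fh] by blast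
  let ?B = "1 / (1 - t) * norm_inf f"
  have gb: "norm (f w / (1 - complex_of_real t * w)) \<le> ?B" if "w \<in> \<D>" for w
    using Cesaro_integrand_bound[OF t f that] by simp
  show ?thesis
  proof (cases "z = 0")
    case True
    then show ?thesis using gb[of 0] z G(3)[of 0] by simp
  next
    case False
    have "norm (G z - G 0) \<le> ?B * norm (z - 0)"
      by (rule field_differentiable_bound[OF convex_ball[of 0 1] has_field_derivative_at_within[OF G(2)] gb])
        (use z in auto)
    then have "norm (G z) \<le> ?B * norm z"
      by (simp only: G(1) diff_zero)
    then have "norm (G z) / norm z \<le> ?B"
      using False by (subst pos_divide_le_eq) simp_all
    then show ?thesis
      using False by (simp only: G(3)[OF z] if_False norm_divide)
  qed
qed

lemma Cesaro_linear:
  assumes t: "0 \<le> t" "t < 1" and f: "f \<in> hol_disc" and g: "g \<in> hol_disc"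
  shows "Cesaro t (\<lambda>z. a * f z + b * g z) = (\<lambda>z. a * Cesaro t f z + b * Cesaro t g z)"
proof
  fix z
  show "Cesaro t (\<lambda>z. a * f z + b * g z) z = a * Cesaro t f z + b * Cesaro t g z"
  proof (cases "z \<in> \<D> \<and> z \<noteq> 0")
    case True
    have int: "(\<lambda>\<xi>. h \<xi> / (1 - complex_of_real t * \<xi>)) contour_integrable_on linepath 0 z"
      if "h \<in> hol_disc" for h
    proof -
      have "closed_segment 0 z \<subseteq> \<D>"
        using True by (intro closed_segment_subset) auto
      moreover have "continuous_on \<D> (\<lambda>\<xi>. h \<xi> / (1 - complex_of_real t * \<xi>))"
        using holomorphic_Cesaro_integrand[OF t, of h] that
        by (auto simp: hol_disc_def intro: holomorphic_on_imp_continuous_on)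
      ultimately show ?thesis
        by (intro contour_integrable_continuous_linepath) (rule continuous_on_subset)
    qed
    have "contour_integral (linepath 0 z)
            (\<lambda>\<xi>. a * (f \<xi> / (1 - complex_of_real t * \<xi>)) + b * (g \<xi> / (1 - complex_of_real t * \<xi>)))
        = a * contour_integral (linepath 0 z) (\<lambda>\<xi>. f \<xi> / (1 - complex_of_real t * \<xi>))
        + b * contour_integral (linepath 0 z) (\<lambda>\<xi>. g \<xi> / (1 - complex_of_real t * \<xi>))"
      using int[OF f] int[OF g]
      by (simp only: contour_integral_add contour_integral_lmul contour_integrable_lmul)
    then show ?thesis using True by (simp add: Cesaro_def add_divide_distrib)
  qed (auto simp: Cesaro_def)
qed

lemma norm_inf_Cesaro_le:
  assumes "0 \<le> t" "t < 1" "f \<in> Hinf"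
  shows "norm_inf (Cesaro t f) \<le> 1 / (1 - t) * norm_inf f"
  unfolding norm_inf_def[of "Cesaro t f"]
  by (rule cSUP_least[OF _ Cesaro_bound[OF assms]]) auto

lemma bounded_operator_on_Hinf_Cesaro:
  assumes t: "0 \<le> t" "t < 1"
  shows "bounded_operator_on Hinf (Cesaro t)"
  unfolding bounded_operator_on_def
proof (intro conjI ballI allI exI)
  fix f assume f: "f \<in> Hinf"
  have "bounded (Cesaro t f ` \<D>)"
    unfolding bounded_iff
    by (rule exI[of _ "1 / (1 - t) * norm_inf f"]) (intro ballI, elim imageE, simp only: Cesaro_bound[OF t f])
  moreover have "Cesaro t f \<in> hol_disc"
    using f by (intro Cesaro_hol_disc[OF t]) (simp add: Hinf_def)
  ultimately show "Cesaro t f \<in> Hinf" by (simp add: Hinf_def)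
next
  fix f g a b assume "f \<in> Hinf" "g \<in> Hinf"
  then show "Cesaro t (\<lambda>z. a * f z + b * g z) = (\<lambda>z. a * Cesaro t f z + b * Cesaro t g z)"
    using Cesaro_linear[OF t] by (simp add: Hinf_def)
next
  fix f assume "f \<in> Hinf"
  then show "norm_inf (Cesaro t f) \<le> 1 / (1 - t) * norm_inf f"
    by (rule norm_inf_Cesaro_le[OF t])
qed

lemma bounded_operator_on_disc_algebra_Cesaro:
  assumes t: "0 \<le> t" "t < 1"
  shows "bounded_operator_on disc_algebra (Cesaro t)"
  unfolding bounded_operator_on_def
proof (intro conjI ballI allI exI)
  fix f assume fA: "f \<in> disc_algebra"
  then have f: "f \<in> Hinf"
    using disc_algebra_subset_Hinf by blast
  then have fh: "f \<in> hol_disc"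
    by (simp add: Hinf_def)
  obtain G where G: "G 0 = 0"
    "\<And>z. z \<in> \<D> \<Longrightarrow> (G has_field_derivative f z / (1 - complex_of_real t * z)) (at z)"
    "\<And>z. z \<in> \<D> \<Longrightarrow> Cesaro t f z = (if z = 0 then f 0 else G z / z)"
    using Cesaro_primitive[OF t fh] by blast
  note gb = Cesaro_integrand_bound[OF t f]
  have "norm_inf f / (1 - t) \<ge> 0"
    using norm_inf_nonneg[OF f] t by simp
  moreover have "norm (G w - G z) \<le> norm_inf f / (1 - t) * norm (w - z)"
    if "z \<in> \<D>" "w \<in> \<D>" for w z
    by (rule field_differentiable_bound[OF convex_ball[of 0 1] has_field_derivative_at_within[OF G(2)] gb])
      (use that in auto)
  ultimately have "(norm_inf f / (1 - t))-lipschitz_on \<D> G"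
    by (intro lipschitz_onI) (auto simp: dist_norm)
  then have "uniformly_continuous_on \<D> G"
    by (rule lipschitz_on_uniformly_continuous)
  then obtain H where H: "uniformly_continuous_on (closure \<D>) H" "\<And>z. z \<in> \<D> \<Longrightarrow> G z = H z"
    using uniformly_continuous_on_extension_on_closure by metis
  define h where "h z = (if z = 0 then f 0 else H z / z)" for z
  have eq: "h z = Cesaro t f z" if "z \<in> \<D>" for z
    using G(3)[OF that] H(2)[OF that] by (simp add: h_def)
  have "continuous_on (\<D> \<union> (closure \<D> - {0})) h"
  proof (rule continuous_on_Un_local_open)
    have un: "\<D> \<union> (closure \<D> - {0}) = closure \<D>"
      using closure_subset[of \<D>] by auto
    show "openin (top_of_set (\<D> \<union> (closure \<D> - {0}))) \<D>"
      unfolding un using closure_subset by (intro open_subset) auto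
    show "openin (top_of_set (\<D> \<union> (closure \<D> - {0}))) (closure \<D> - {0})"
      unfolding un by (intro openin_delete) auto
    have "continuous_on \<D> (Cesaro t f)"
      using Cesaro_hol_disc[OF t fh]
      by (auto simp: hol_disc_def intro: holomorphic_on_imp_continuous_on)
    then show "continuous_on \<D> h"
      using eq continuous_on_cong[of \<D> \<D> h "Cesaro t f"] by simp
    have "continuous_on (closure \<D> - {0}) H"
      using uniformly_continuous_imp_continuous[OF H(1)] by (rule continuous_on_subset) auto
    then have "continuous_on (closure \<D> - {0}) (\<lambda>z. H z / z)"
      by (intro continuous_intros) auto
    then show "continuous_on (closure \<D> - {0}) h"
      by (rule continuous_on_eq) (auto simp: h_def)
  qed
  moreover have "\<D> \<union> (closure \<D> - {0}) = closure \<D>"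
    using closure_subset[of \<D>] by auto
  ultimately have "continuous_on (closure \<D>) h" by simp
  then show "Cesaro t f \<in> disc_algebra"
    using Cesaro_hol_disc[OF t fh] eq unfolding disc_algebra_def by blast
next
  fix f g a b assume "f \<in> disc_algebra" "g \<in> disc_algebra"
  then show "Cesaro t (\<lambda>z. a * f z + b * g z) = (\<lambda>z. a * Cesaro t f z + b * Cesaro t g z)"
    using Cesaro_linear[OF t] by (simp add: disc_algebra_def)
next
  fix f assume "f \<in> disc_algebra"
  then show "norm_inf (Cesaro t f) \<le> 1 / (1 - t) * norm_inf f"
    using norm_inf_Cesaro_le[OF t] disc_algebra_subset_Hinf by blast
qed

end

theory Submission
  imports Defs
begin

text \<open>
  The powers of \<open>z\<close> give a filtration of \<open>H\<^sup>\<infinity>\<close> by the subspaces \<open>z\<^sup>n H\<^sup>\<infinity>\<close>, and \<open>C\<^sub>t\<close> respects it.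
  Two facts about this filtration carry the proof.

  First, each quotient \<open>z\<^sup>n H\<^sup>\<infinity> / z\<^sup>n\<^sup>+\<^sup>1 H\<^sup>\<infinity>\<close> is spanned by the explicit eigenfunction
  \<open>z\<^sup>n / (1 - t z)\<^sup>n\<^sup>+\<^sup>1\<close>, whose eigenvalue is \<open>1 / (n + 1)\<close> (\<open>Cesaro_eigenfunction\<close>,
  \<open>power_bounded_split\<close>). Second, integrating \<open>\<xi>\<^sup>n\<close> gains a factor \<open>n + 1\<close>, so that \<open>C\<^sub>t\<close> has norm at
  most \<open>1 / ((n + 1) (1 - t))\<close> on \<open>z\<^sup>n H\<^sup>\<infinity>\<close> (\<open>power_bounded_Cesaro\<close>).

  Let \<open>l\<close> be nonzero and different from every \<open>1 / (m + 1)\<close>. For large \<open>n\<close> the norm on \<open>z\<^sup>n H\<^sup>\<infinity>\<close> is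
  below \<open>\<bar>l\<bar>\<close>, so a Neumann series inverts \<open>l - C\<^sub>t\<close> there
  (\<open>shifted_Cesaro_solvable_high_order\<close>). Passing from \<open>z\<^sup>n\<^sup>+\<^sup>1 H\<^sup>\<infinity>\<close> back to \<open>z\<^sup>n H\<^sup>\<infinity>\<close> adds one
  eigenfunction, on which \<open>l - C\<^sub>t\<close> is multiplication by the nonzero number \<open>l - 1 / (n + 1)\<close>.
  After finitely many such steps \<open>l - C\<^sub>t\<close> is inverted, with a bound, on all of \<open>H\<^sup>\<infinity>\<close>
  (\<open>shifted_Cesaro_solvable\<close>). Read upwards, the same argument shows that an element of the kernel of
  \<open>l - C\<^sub>t\<close> lies in every \<open>z\<^sup>n H\<^sup>\<infinity>\<close> and therefore vanishes (\<open>shifted_Cesaro_kernel_trivial\<close>).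
  The point 0 is in the spectrum because an inverse of \<open>C\<^sub>t\<close> would have the unbounded sequence of
  eigenvalues \<open>n + 1\<close>; it is not an eigenvalue because \<open>f\<close> can be recovered from \<open>C\<^sub>t f\<close> by
  differentiation (\<open>Cesaro_injective\<close>).

  Both spaces are treated together. The operator \<open>C\<^sub>t\<close> maps \<open>H\<^sup>\<infinity>\<close> into the disc algebra
  (\<open>Cesaro_Hinf_disc_algebra\<close>), so a solution \<open>f\<close> of \<open>l f - C\<^sub>t f = h\<close> in \<open>H\<^sup>\<infinity>\<close> is as regular
  as \<open>h\<close>, and the spectra agree on every space between the two (\<open>spectra_Cesaro_intermediate\<close>).
\<close>

section \<open>Linear combinations and the supremum norm\<close>

lemma hol_disc_lincomb:
  assumes "f \<in> hol_disc" "g \<in> hol_disc"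
  shows "(\<lambda>z. a * f z + b * g z) \<in> hol_disc"
  using assms by (auto simp: hol_disc_def intro!: holomorphic_intros)

lemma Hinf_lincomb:
  assumes "f \<in> Hinf" "g \<in> Hinf"
  shows "(\<lambda>z. a * f z + b * g z) \<in> Hinf"
proof -
  have "norm (a * f z + b * g z) \<le> norm a * norm_inf f + norm b * norm_inf g" if "z \<in> \<D>" for z
    using norm_triangle_ineq[of "a * f z" "b * g z"]
      mult_left_mono[OF norm_le_norm_inf[OF assms(1) that], of "norm a"]
      mult_left_mono[OF norm_le_norm_inf[OF assms(2) that], of "norm b"]
    by (simp add: norm_mult)
  then have "bounded ((\<lambda>z. a * f z + b * g z) ` \<D>)"
    unfolding bounded_iff by blast
  then show ?thesis
    using hol_disc_lincomb[of f g a b] assms by (simp add: Hinf_def)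
qed

lemma disc_algebra_lincomb:
  assumes "f \<in> disc_algebra" "g \<in> disc_algebra"
  shows "(\<lambda>z. a * f z + b * g z) \<in> disc_algebra"
proof -
  obtain F G where F: "continuous_on (closure \<D>) F" "\<forall>z\<in>\<D>. F z = f z"
    and G: "continuous_on (closure \<D>) G" "\<forall>z\<in>\<D>. G z = g z"
    using assms by (auto simp: disc_algebra_def)
  have "continuous_on (closure \<D>) (\<lambda>z. a * F z + b * G z)"
    by (intro continuous_intros F G)
  then show ?thesis
    using hol_disc_lincomb[of f g a b] assms F(2) G(2)
    unfolding disc_algebra_def mem_Collect_eq by (intro conjI exI[of _ "\<lambda>z. a * F z + b * G z"]) auto
qed

lemma norm_inf_eq_0_imp:
  assumes "f \<in> Hinf" "norm_inf f = 0"
  shows "f = (\<lambda>_. 0)"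
proof
  show "f z = 0" for z
    using norm_le_norm_inf[OF assms(1), of z] assms
    by (cases "z \<in> \<D>") (auto simp: Hinf_def hol_disc_def)
qed

lemma norm_eigenvalue_le:
  assumes e: "e \<in> Hinf" "e \<noteq> (\<lambda>_. 0)" and le: "norm_inf (\<lambda>z. c * e z) \<le> K * norm_inf e"
  shows "norm c \<le> K"
proof -
  have "norm_inf e \<noteq> 0" using norm_inf_eq_0_imp e by blast
  with norm_inf_nonneg[OF e(1)] have pos: "0 < norm_inf e" by simp
  have ce: "(\<lambda>z. c * e z) \<in> Hinf" using Hinf_lincomb[OF e(1) e(1), of c 0] by simp
  have K: "0 \<le> K * norm_inf e" using norm_inf_nonneg[OF ce] le by linarith
  show ?thesis
  proof (cases "c = 0")
    case True
    then show ?thesis using K pos by (simp add: zero_le_mult_iff)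
  next
    case False
    have "norm (e z) \<le> K * norm_inf e / norm c" if "z \<in> \<D>" for z
    proof -
      have "norm c * norm (e z) \<le> K * norm_inf e"
        using norm_le_norm_inf[OF ce that] le by (simp add: norm_mult)
      then show ?thesis using False by (simp add: field_simps)
    qed
    then have "norm_inf e \<le> K * norm_inf e / norm c"
      unfolding norm_inf_def[of e] by (intro cSUP_least) (auto simp flip: norm_inf_def)
    then have "norm c * norm_inf e \<le> K * norm_inf e" using False by (simp add: field_simps)
    then show ?thesis using pos by simp
  qed
qed

lemma shifted_lincomb:
  assumes "0 \<le> t" "t < 1" "f \<in> hol_disc" "g \<in> hol_disc"
  shows "shifted l (Cesaro t) (\<lambda>z. a * f z + b * g z) =
    (\<lambda>z. a * shifted l (Cesaro t) f z + b * shifted l (Cesaro t) g z)"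
  unfolding shifted_def Cesaro_linear[OF assms] by (simp add: algebra_simps)

section \<open>Functions with a prescribed order of vanishing at the origin\<close>

text \<open>
  Membership in \<open>z\<^sup>n H\<^sup>\<infinity>\<close> together with the bound \<open>\<parallel>f / z\<^sup>n\<parallel> \<le> M\<close>. Stating the bound as an inequality
  for \<open>f\<close> itself avoids the division at the origin; the bound \<open>M\<close> is kept explicit because boundedness
  of the inverse operator has to be tracked through the whole construction.
\<close>

definition power_bounded :: "nat \<Rightarrow> real \<Rightarrow> (complex \<Rightarrow> complex) \<Rightarrow> bool"
  where "power_bounded n M f \<longleftrightarrow> f \<in> hol_disc \<and> (\<forall>z\<in>\<D>. norm (f z) \<le> M * norm z ^ n)"

lemma power_bounded_hol_disc: "power_bounded n M f \<Longrightarrow> f \<in> hol_disc"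
  by (simp add: power_bounded_def)

lemma power_bounded_norm_le: "power_bounded n M f \<Longrightarrow> z \<in> \<D> \<Longrightarrow> norm (f z) \<le> M * norm z ^ n"
  by (simp add: power_bounded_def)

lemma power_bounded_nonneg:
  assumes "power_bounded n M f"
  shows "0 \<le> M"
proof -
  have "0 \<le> M * norm (1/2 :: complex) ^ n"
    by (rule order_trans[OF norm_ge_zero power_bounded_norm_le[OF assms]]) auto
  moreover have "0 < norm (1/2 :: complex) ^ n" by simp
  ultimately show ?thesis by (meson linorder_not_le mult_neg_pos)
qed

lemma power_bounded_imp_bound:
  assumes "power_bounded n M f" "z \<in> \<D>"
  shows "norm (f z) \<le> M"
proof -
  have "M * norm z ^ n \<le> M * 1"
    using assms power_bounded_nonneg[OF assms(1)] by (intro mult_left_mono power_le_one) auto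
  with power_bounded_norm_le[OF assms] show ?thesis by simp
qed

lemma power_bounded_imp_Hinf: "power_bounded n M f \<Longrightarrow> f \<in> Hinf"
  using power_bounded_imp_bound power_bounded_hol_disc unfolding Hinf_def bounded_iff by blast

lemma power_bounded_0_of_Hinf:
  assumes "f \<in> Hinf" "norm_inf f \<le> M"
  shows "power_bounded 0 M f"
  using assms(1) order_trans[OF norm_le_norm_inf[OF assms(1)] assms(2)]
  by (auto simp: power_bounded_def Hinf_def)

lemma power_bounded_mono: "power_bounded n M f \<Longrightarrow> M \<le> M' \<Longrightarrow> power_bounded n M' f"
  unfolding power_bounded_def by (meson mult_right_mono norm_ge_zero order_trans zero_le_power)

lemma power_bounded_lower_order:
  assumes "power_bounded (Suc n) M f"
  shows "power_bounded n M f"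
proof -
  have "M * norm z ^ Suc n \<le> M * norm z ^ n" if "z \<in> \<D>" for z
    using that power_bounded_nonneg[OF assms]
    by (intro mult_left_mono power_decreasing) auto
  then show ?thesis
    using assms unfolding power_bounded_def by (meson order_trans)
qed

lemma power_bounded_lincomb:
  assumes "power_bounded n M f" "power_bounded n N g"
  shows "power_bounded n (norm a * M + norm b * N) (\<lambda>z. a * f z + b * g z)"
proof -
  have "norm (a * f z + b * g z) \<le> (norm a * M + norm b * N) * norm z ^ n" if "z \<in> \<D>" for z
    using norm_triangle_ineq[of "a * f z" "b * g z"]
      mult_left_mono[OF power_bounded_norm_le[OF assms(1) that], of "norm a"]
      mult_left_mono[OF power_bounded_norm_le[OF assms(2) that], of "norm b"]
    by (simp add: norm_mult algebra_simps)
  then show ?thesis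
    using assms hol_disc_lincomb by (auto simp: power_bounded_def)
qed

text \<open>
  On the segment from \<open>0\<close> to \<open>z\<close> the integrand is at most \<open>M \<bar>\<xi>\<bar>\<^sup>n / (1 - t)\<close>, and the integral of
  \<open>\<bar>\<xi>\<bar>\<^sup>n\<close> over it is \<open>\<bar>z\<bar>\<^sup>n\<^sup>+\<^sup>1 / (n + 1)\<close>. The gain of the factor \<open>n + 1\<close> is what makes \<open>C\<^sub>t\<close> small
  on functions that vanish to high order.
\<close>
lemma power_bounded_Cesaro:
  assumes t: "0 \<le> t" "t < 1" and f: "power_bounded n M f"
  shows "power_bounded n (M / ((real n + 1) * (1 - t))) (Cesaro t f)"
  unfolding power_bounded_def
proof (intro conjI ballI)
  have fh: "f \<in> hol_disc" using f by (rule power_bounded_hol_disc)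
  show "Cesaro t f \<in> hol_disc" by (rule Cesaro_hol_disc[OF t fh])
  fix z :: complex assume z: "z \<in> \<D>"
  obtain G where G: "G 0 = 0"
    "\<And>z. z \<in> \<D> \<Longrightarrow> (G has_field_derivative f z / (1 - complex_of_real t * z)) (at z)"
    "\<And>z. z \<in> \<D> \<Longrightarrow> Cesaro t f z = (if z = 0 then f 0 else G z / z)"
    using Cesaro_primitive[OF t fh] by blast
  let ?K = "M / ((real n + 1) * (1 - t))"
  have M: "0 \<le> M" by (rule power_bounded_nonneg[OF f])
  show "norm (Cesaro t f z) \<le> ?K * norm z ^ n"
  proof (cases "z = 0")
    case True
    have "norm (f 0) \<le> M * 0 ^ n"
      using power_bounded_norm_le[OF f, of 0] by simp
    also have "\<dots> \<le> ?K * 0 ^ n"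
      using t M by (cases n) (auto simp: field_simps mult_left_le)
    finally show ?thesis using True G(3)[of 0] by simp
  next
    case False
    let ?\<phi> = "\<lambda>s::real. ?K * norm z ^ Suc n * s ^ Suc n"
    have disc: "complex_of_real s * z \<in> \<D>" if "0 \<le> s" "s \<le> 1" for s
    proof -
      have "s * norm z \<le> 1 * norm z" using that by (intro mult_right_mono) auto
      then show ?thesis using z that by (simp add: norm_mult)
    qed
    have der: "((\<lambda>s. G (complex_of_real s * z)) has_vector_derivative
        z * (f (complex_of_real s * z) / (1 - complex_of_real t * (complex_of_real s * z)))) (at s)"
      if "0 \<le> s" "s \<le> 1" for s
    proof -
      have "((\<lambda>s. complex_of_real s * z) has_vector_derivative z) (at s)"
        by (auto intro!: derivative_eq_intros simp: has_vector_derivative_def scaleR_conv_of_real)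
      from field_vector_diff_chain_at[OF this G(2)[OF disc[OF that]]]
      show ?thesis by (simp add: o_def)
    qed
    have "norm (G (complex_of_real 1 * z) - G (complex_of_real 0 * z)) \<le> ?\<phi> 1 - ?\<phi> 0"
    proof (rule differentiable_bound_general[where f = "\<lambda>s. G (complex_of_real s * z)" and \<phi> = ?\<phi>])
      show "continuous_on {0..1} (\<lambda>s. G (complex_of_real s * z))"
        by (rule continuous_at_imp_continuous_on)
          (auto intro!: has_vector_derivative_continuous[OF der])
      fix s :: real assume s: "0 < s" "s < 1"
      let ?w = "complex_of_real s * z"
      show "(?\<phi> has_vector_derivative M / (1 - t) * norm z ^ Suc n * s ^ n) (at s)"
        using DERIV_cmult[OF DERIV_pow[of "Suc n" s UNIV], of "?K * norm z ^ Suc n"] t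
        by (simp add: has_real_derivative_iff_has_vector_derivative add.commute mult_ac)
      have w: "?w \<in> \<D>" using disc s by simp
      have "norm (f ?w / (1 - complex_of_real t * ?w)) \<le> (M * norm ?w ^ n) / (1 - t)"
        unfolding norm_divide
        using one_minus_mult_bound[OF t w] power_bounded_norm_le[OF f w] t M
        by (intro frac_le) auto
      then have "norm z * norm (f ?w / (1 - complex_of_real t * ?w)) \<le> norm z * ((M * norm ?w ^ n) / (1 - t))"
        by (rule mult_left_mono) simp
      then show "norm (z * (f ?w / (1 - complex_of_real t * ?w))) \<le> M / (1 - t) * norm z ^ Suc n * s ^ n"
        using s by (simp add: norm_mult power_mult_distrib mult_ac norm_divide)
    qed (use der t in \<open>auto intro!: continuous_intros\<close>)
    then have "norm (G z) \<le> ?K * norm z ^ n * norm z"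
      using G(1) by (simp add: mult_ac)
    then have "norm (G z) / norm z \<le> ?K * norm z ^ n"
      using False by (subst pos_divide_le_eq) auto
    then show ?thesis using False G(3)[OF z] by (simp only: if_False norm_divide)
  qed
qed

section \<open>Eigenfunctions\<close>

definition eigenfunction :: "real \<Rightarrow> nat \<Rightarrow> complex \<Rightarrow> complex"
  where "eigenfunction t n z =
    (if z \<in> \<D> then z ^ n / (1 - complex_of_real t * z) ^ Suc n else 0)"

lemma one_minus_mult_nonzero:
  assumes "0 \<le> t" "t < 1" "norm z \<le> 1"
  shows "1 - complex_of_real t * z \<noteq> 0"
proof
  assume "1 - complex_of_real t * z = 0"
  then have "norm (complex_of_real t * z) = 1" by (metis eq_iff_diff_eq_0 norm_one)
  moreover have "norm (complex_of_real t * z) \<le> t * 1"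
    using assms by (simp add: norm_mult mult_left_le)
  ultimately show False using assms by simp
qed

lemma one_minus_mult_le_2:
  assumes "0 \<le> t" "t \<le> 1" "norm z \<le> 1"
  shows "norm (1 - complex_of_real t * z) \<le> 2"
proof -
  have "norm (complex_of_real t * z) \<le> 1"
    using assms by (simp add: norm_mult mult_le_one)
  then show ?thesis
    using norm_triangle_ineq4[of 1 "complex_of_real t * z"] by simp
qed

lemma eigenfunction_disc_algebra:
  assumes "0 \<le> t" "t < 1"
  shows "eigenfunction t n \<in> disc_algebra"
proof -
  let ?g = "\<lambda>z. z ^ n / (1 - complex_of_real t * z) ^ Suc n"
  note nz = one_minus_mult_nonzero[OF assms]
  have "?g holomorphic_on \<D>"
    using nz by (intro holomorphic_intros) auto
  then have "eigenfunction t n holomorphic_on \<D>"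
    by (rule holomorphic_transform) (simp add: eigenfunction_def)
  moreover have "continuous_on (closure \<D>) ?g"
    using nz by (intro continuous_intros) auto
  ultimately show ?thesis
    unfolding disc_algebra_def hol_disc_def
    by (auto simp: eigenfunction_def intro!: exI[of _ ?g])
qed

lemma eigenfunction_hol_disc:
  "0 \<le> t \<Longrightarrow> t < 1 \<Longrightarrow> eigenfunction t n \<in> hol_disc"
  using eigenfunction_disc_algebra by (auto simp: disc_algebra_def)

lemma eigenfunction_norm_bounds:
  assumes t: "0 \<le> t" "t < 1" and z: "z \<in> \<D>"
  shows "norm z ^ n / 2 ^ Suc n \<le> norm (eigenfunction t n z)"
    and "norm (eigenfunction t n z) \<le> norm z ^ n / (1 - t) ^ Suc n"
proof -
  have lo: "1 - t \<le> norm (1 - complex_of_real t * z)"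
    by (rule one_minus_mult_bound[OF t z])
  have hi: "norm (1 - complex_of_real t * z) \<le> 2"
    using one_minus_mult_le_2[of t z] t z by simp
  have eq: "norm (eigenfunction t n z) = norm z ^ n / norm (1 - complex_of_real t * z) ^ Suc n"
    using z by (simp add: eigenfunction_def norm_divide norm_mult norm_power)
  show "norm z ^ n / 2 ^ Suc n \<le> norm (eigenfunction t n z)"
    unfolding eq using hi lo t by (intro frac_le power_mono zero_less_power) auto
  show "norm (eigenfunction t n z) \<le> norm z ^ n / (1 - t) ^ Suc n"
    unfolding eq using lo t by (intro frac_le power_mono zero_less_power) auto
qed

text \<open>
  The substitution \<open>w = \<xi> / (1 - t \<xi>)\<close> has \<open>dw = d\<xi> / (1 - t \<xi>)\<^sup>2\<close>, so it turns the integrand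
  \<open>\<xi>\<^sup>n / (1 - t \<xi>)\<^sup>n\<^sup>+\<^sup>2\<close> into \<open>w\<^sup>n\<close>.
\<close>
lemma Cesaro_eigenfunction:
  assumes t: "0 \<le> t" "t < 1"
  shows "Cesaro t (eigenfunction t n) = (\<lambda>z. 1 / (of_nat n + 1) * eigenfunction t n z)"
proof
  fix z
  let ?q = "\<lambda>z. 1 - complex_of_real t * z"
  obtain G where G: "G 0 = 0"
    "\<And>z. z \<in> \<D> \<Longrightarrow> (G has_field_derivative eigenfunction t n z / ?q z) (at z)"
    "\<And>z. z \<in> \<D> \<Longrightarrow> Cesaro t (eigenfunction t n) z = (if z = 0 then eigenfunction t n 0 else G z / z)"
    using Cesaro_primitive[OF t eigenfunction_hol_disc[OF t]] by blast
  define P where "P = (\<lambda>z. 1 / (of_nat n + 1) * (z / ?q z) ^ Suc n)"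
  have P: "(P has_field_derivative eigenfunction t n z / ?q z) (at z)" if z: "z \<in> \<D>" for z
  proof -
    have nz: "?q z \<noteq> 0" using one_minus_mult_nonzero[OF t, of z] z by simp
    have "((\<lambda>z. z / ?q z) has_field_derivative (?q z + z * complex_of_real t) / (?q z * ?q z)) (at z)"
      using nz by (auto intro!: derivative_eq_intros)
    then have "((\<lambda>z. z / ?q z) has_field_derivative 1 / (?q z * ?q z)) (at z)"
      by (simp add: mult.commute)
    from DERIV_cmult[OF DERIV_power[OF this, of "Suc n"], of "1 / (of_nat n + 1)"]
    have "(P has_field_derivative 1 / (of_nat n + 1) *
        (of_nat (Suc n) * (1 / (?q z * ?q z) * (z / ?q z) ^ n))) (at z)"
      unfolding P_def by simp
    moreover have "1 / (of_nat n + 1) * (of_nat (Suc n) * (1 / (?q z * ?q z) * (z / ?q z) ^ n))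
        = eigenfunction t n z / ?q z"
    proof -
      have "of_nat (Suc n) \<noteq> (0::complex)" by (simp only: of_nat_eq_0_iff)
      then show ?thesis
        using z nz by (simp add: eigenfunction_def power_divide add.commute)
    qed
    ultimately show ?thesis by simp
  qed
  have GP: "G z = P z" if "z \<in> \<D>" for z
  proof -
    have "((\<lambda>z. G z - P z) has_field_derivative 0) (at x within \<D>)" if "x \<in> \<D>" for x
      using DERIV_diff[OF G(2)[OF that] P[OF that]] by (simp add: has_field_derivative_at_within)
    then obtain c where "\<And>x. x \<in> \<D> \<Longrightarrow> G x - P x = c"
      using has_field_derivative_zero_constant[OF convex_ball, of 0 1 "\<lambda>z. G z - P z"] by blast
    from this[of 0] this[OF that] show ?thesis by (simp add: G(1) P_def)
  qed
  show "Cesaro t (eigenfunction t n) z = 1 / (of_nat n + 1) * eigenfunction t n z"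
  proof (cases "z \<in> \<D>")
    case True
    show ?thesis
    proof (cases "z = 0")
      case True
      then show ?thesis using G(3)[of 0] by (cases n) (simp_all add: eigenfunction_def)
    next
      case False
      then show ?thesis
        using True G(3)[OF True] GP[OF True]
        by (simp add: P_def eigenfunction_def power_divide)
    qed
  qed (simp add: Cesaro_def eigenfunction_def)
qed

text \<open>
  Dividing \<open>f\<close> by the eigenfunction leaves a bounded function \<open>g\<close> with a removable singularity at the
  origin. Its value there is the coefficient \<open>c\<close>, and \<open>g - g 0\<close> gains one order of vanishing by the
  Schwarz lemma. Both estimates are linear in \<open>M\<close>, so the splitting is bounded as an operation on \<open>f\<close>;
  the proof rescales by a multiple of \<open>M\<close>, hence \<open>0 < M\<close>.
\<close>
lemma power_bounded_split:
  assumes t: "0 \<le> t" "t < 1" and M: "0 < M" and f: "power_bounded n M f"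
  obtains c where "norm c \<le> 2 ^ Suc n * M"
    and "power_bounded (Suc n) (3 * (2 / (1 - t)) ^ Suc n * M) (\<lambda>z. f z - c * eigenfunction t n z)"
proof -
  let ?q = "\<lambda>z. 1 - complex_of_real t * z"
  let ?B = "2 ^ Suc n * M"
  have fh: "f holomorphic_on \<D>" using f by (simp add: power_bounded_def hol_disc_def)
  define v where "v = (\<lambda>z. f z * ?q z ^ Suc n / z ^ n)"
  have v_bound: "norm (v z) \<le> ?B" if "z \<in> \<D> - {0}" for z
  proof -
    have z: "z \<in> \<D>" "z \<noteq> 0" using that by auto
    have "norm (?q z) \<le> 2" using one_minus_mult_le_2[of t z] t z by simp
    then have "norm (f z) * norm (?q z) ^ Suc n \<le> (M * norm z ^ n) * 2 ^ Suc n"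
      using power_bounded_norm_le[OF f z(1)] M by (intro mult_mono power_mono) auto
    then show ?thesis
      using z by (simp add: v_def norm_divide norm_mult norm_power divide_simps mult_ac)
  qed
  have "v holomorphic_on \<D> - {0}"
    unfolding v_def using fh by (intro holomorphic_intros) (auto intro: holomorphic_on_subset)
  moreover have "\<forall>\<^sub>F z in at 0. norm (v z) \<le> ?B"
    using v_bound by (auto simp: eventually_at intro!: exI[of _ 1])
  ultimately obtain g where g: "g holomorphic_on \<D>" and gv: "\<And>z. z \<in> \<D> - {0} \<Longrightarrow> g z = v z"
    using holomorphic_on_extend_bounded[of v \<D> 0] by (auto simp: interior_open)
  \<comment> \<open>The bound for \<open>v\<close> passes to \<open>g\<close> at the origin by continuity.\<close>
  have g0: "norm (g 0) \<le> ?B"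
  proof (rule tendsto_upperbound)
    have "isCont g 0"
      using g by (metis centre_in_ball continuous_on_eq_continuous_at holomorphic_on_imp_continuous_on
          open_ball zero_less_one)
    then show "((\<lambda>z. norm (g z)) \<longlongrightarrow> norm (g 0)) (at 0)"
      by (intro tendsto_norm) (simp add: isCont_def)
    show "\<forall>\<^sub>F z in at 0. norm (g z) \<le> ?B"
      using v_bound gv by (auto simp: eventually_at intro!: exI[of _ 1])
  qed simp
  have g_bound: "norm (g z) \<le> ?B" if "z \<in> \<D>" for z
    using that g0 gv[of z] v_bound[of z] by (cases "z = 0") auto
  have B: "?B > 0" using M by simp
  \<comment> \<open>The values of \<open>g - g 0\<close> are at most \<open>2 * ?B\<close>; the factor 3 gives the strict inequality
      in the hypothesis of the Schwarz lemma.\<close>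
  have schwarz: "norm (g z - g 0) \<le> 3 * ?B * norm z" if z: "z \<in> \<D>" for z
  proof -
    have "norm ((g z - g 0) / of_real (3 * ?B)) \<le> norm z"
    proof (rule Schwarz_Lemma(1)[where f = "\<lambda>z. (g z - g 0) / of_real (3 * ?B)"])
      show "(\<lambda>z. (g z - g 0) / of_real (3 * ?B)) holomorphic_on \<D>"
        using g M by (intro holomorphic_intros) auto
      fix w :: complex assume "norm w < 1"
      then have "norm (g w - g 0) < 3 * ?B"
        using norm_triangle_ineq4[of "g w" "g 0"] g0 g_bound[of w] B \<open>norm w < 1\<close>
        by (smt (verit) mem_ball_0)
      then show "norm ((g w - g 0) / of_real (3 * ?B)) < 1"
        using B M by (simp add: norm_divide norm_mult norm_power)
    qed (use z in auto)
    then show ?thesis using B M by (simp add: norm_divide norm_mult norm_power divide_simps mult_ac)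
  qed
  have "power_bounded (Suc n) (3 * (2 / (1 - t)) ^ Suc n * M) (\<lambda>z. f z - g 0 * eigenfunction t n z)"
    unfolding power_bounded_def
  proof (intro conjI ballI)
    show "(\<lambda>z. f z - g 0 * eigenfunction t n z) \<in> hol_disc"
      using hol_disc_lincomb[OF power_bounded_hol_disc[OF f] eigenfunction_hol_disc[OF t], of 1 "- g 0"]
      by simp
    fix z assume z: "z \<in> \<D>"
    have nz: "?q z \<noteq> 0" using one_minus_mult_nonzero[OF t, of z] z by simp
    have "f z = g z * eigenfunction t n z"
    proof (cases "z = 0")
      case True
      show ?thesis
      proof (cases n)
        case 0
        have "isCont g 0" "isCont f 0"
          using g fh by (metis centre_in_ball continuous_on_eq_continuous_at holomorphic_on_imp_continuous_on
              open_ball zero_less_one)+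
        then have lim: "((\<lambda>z. f z * ?q z ^ Suc n - g z) \<longlongrightarrow> f 0 * ?q 0 ^ Suc n - g 0) (at 0)"
          by (intro tendsto_intros) (auto simp: isCont_def)
        have "\<forall>\<^sub>F z in at 0. f z * ?q z ^ Suc n - g z = 0"
          using gv 0 by (auto simp: eventually_at v_def intro!: exI[of _ 1])
        then have "f 0 * ?q 0 ^ Suc n - g 0 = 0"
          by (rule tendsto_unique[OF at_neq_bot lim tendsto_eventually])
        then show ?thesis using True 0 by (simp add: eigenfunction_def)
      next
        case (Suc k)
        then show ?thesis
          using True power_bounded_norm_le[OF f, of 0] by (simp add: eigenfunction_def)
      qed
    next
      case False
      then show ?thesis using gv[of z] z nz by (simp add: v_def eigenfunction_def)
    qed
    then have "norm (f z - g 0 * eigenfunction t n z) = norm (g z - g 0) * norm (eigenfunction t n z)"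
      by (simp flip: norm_mult add: algebra_simps)
    also have "\<dots> \<le> (3 * ?B * norm z) * (norm z ^ n / (1 - t) ^ Suc n)"
      using schwarz[OF z] eigenfunction_norm_bounds(2)[OF t z] B by (intro mult_mono) auto
    also have "\<dots> = 3 * (2 / (1 - t)) ^ Suc n * M * norm z ^ Suc n"
      by (simp add: power_divide)
    finally show "norm (f z - g 0 * eigenfunction t n z) \<le> \<dots>" .
  qed
  then show thesis using that g0 by blast
qed

lemma power_bounded_eigenfunction:
  "0 \<le> t \<Longrightarrow> t < 1 \<Longrightarrow> power_bounded n (1 / (1 - t) ^ Suc n) (eigenfunction t n)"
  using eigenfunction_hol_disc eigenfunction_norm_bounds(2) by (simp add: power_bounded_def)

text \<open>
  The eigenfunction is bounded below by a multiple of \<open>\<bar>z\<bar>\<^sup>n\<close>, so it has no order higher than \<open>n\<close>;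
  letting \<open>z\<close> tend to \<open>0\<close> along the positive real axis forces \<open>d = 0\<close>.
\<close>
lemma eigenfunction_exact_order:
  assumes t: "0 \<le> t" "t < 1" and "power_bounded (Suc n) K (\<lambda>z. d * eigenfunction t n z)"
  shows "d = 0"
proof -
  have "norm d \<le> (2 ^ Suc n * K) * x" if x: "x \<in> {0<..<1}" for x
  proof -
    have z: "complex_of_real x \<in> \<D>" using x by simp
    have "norm d * (x ^ n / 2 ^ Suc n) \<le> norm d * norm (eigenfunction t n (complex_of_real x))"
      using eigenfunction_norm_bounds(1)[OF t z, of n] x by (intro mult_left_mono) auto
    also have "\<dots> \<le> K * x ^ Suc n"
      using power_bounded_norm_le[OF assms(3) z] x by (simp add: norm_mult)
    finally show ?thesis using x by (simp add: field_simps)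
  qed
  then have "\<forall>\<^sub>F x in at_right 0. norm d \<le> (2 ^ Suc n * K) * x"
    by (auto simp: eventually_at_right_field intro!: exI[of _ 1])
  moreover have "((\<lambda>x. (2 ^ Suc n * K) * x) \<longlongrightarrow> (2 ^ Suc n * K) * 0) (at_right (0::real))"
    by (intro tendsto_intros)
  ultimately have "norm d \<le> (2 ^ Suc n * K) * 0"
    by (intro tendsto_lowerbound[of _ _ "at_right (0::real)"]) auto
  then show ?thesis by simp
qed

lemma shifted_eigenfunction:
  assumes "0 \<le> t" "t < 1"
  shows "shifted l (Cesaro t) (eigenfunction t n) = (\<lambda>z. (l - 1 / (of_nat n + 1)) * eigenfunction t n z)"
  unfolding shifted_def Cesaro_eigenfunction[OF assms] by (simp add: algebra_simps)

lemma eigenfunction_nonzero: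
  assumes "0 \<le> t" "t < 1"
  shows "eigenfunction t n \<noteq> (\<lambda>_. 0)"
proof
  assume "eigenfunction t n = (\<lambda>_. 0)"
  then have "norm (1/2 :: complex) ^ n / 2 ^ Suc n \<le> 0"
    using eigenfunction_norm_bounds(1)[OF assms, of "1/2" n] by simp
  moreover have "0 < norm (1/2 :: complex) ^ n / 2 ^ Suc n"
    by (intro divide_pos_pos zero_less_power) auto
  ultimately show False by linarith
qed

section \<open>Surjectivity of the shifted operator\<close>

lemma power_bounded_cmult:
  "power_bounded n M f \<Longrightarrow> power_bounded n (norm a * M) (\<lambda>z. a * f z)"
  using power_bounded_lincomb[of n M f M f a 0] by simp

lemma power_bounded_shifted:
  assumes "0 \<le> t" "t < 1" "power_bounded n M f"
  shows "power_bounded n ((norm l + 1 / ((real n + 1) * (1 - t))) * M) (shifted l (Cesaro t) f)"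
  using power_bounded_lincomb[OF assms(3) power_bounded_Cesaro[OF assms], of l "-1"]
  by (simp add: shifted_def distrib_right)

text \<open>
  The bound \<open>B k\<close> for \<open>f / z\<^sup>n\<close> is also a uniform bound for \<open>f\<close> on the disc, so the series converges
  uniformly there and its sum is holomorphic.
\<close>
lemma power_bounded_suminf:
  assumes u: "\<And>k. power_bounded n (B k) (u k)" and B: "summable B"
  shows "power_bounded n (suminf B) (\<lambda>z. \<Sum>k. u k z)"
  unfolding power_bounded_def
proof (intro conjI ballI)
  have lim: "uniform_limit \<D> (\<lambda>N z. \<Sum>k<N. u k z) (\<lambda>z. \<Sum>k. u k z) sequentially"
    by (rule Weierstrass_m_test[OF _ B]) (rule power_bounded_imp_bound[OF u])
  have "(\<lambda>z. \<Sum>k. u k z) holomorphic_on \<D>"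
  proof (rule holomorphic_uniform_sequence[OF open_ball])
    show "(\<lambda>z. \<Sum>k<N. u k z) holomorphic_on \<D>" for N
      using power_bounded_hol_disc[OF u] by (intro holomorphic_intros) (simp add: hol_disc_def)
    fix x :: complex assume "x \<in> \<D>"
    then obtain d where "0 < d" "cball x d \<subseteq> \<D>"
      by (metis open_ball open_contains_cball)
    then show "\<exists>d>0. cball x d \<subseteq> \<D> \<and>
        uniform_limit (cball x d) (\<lambda>N z. \<Sum>k<N. u k z) (\<lambda>z. \<Sum>k. u k z) sequentially"
      using uniform_limit_on_subset[OF lim] by blast
  qed
  moreover have "(\<Sum>k. u k z) = 0" if "z \<notin> \<D>" for z
    using that power_bounded_hol_disc[OF u] by (simp add: hol_disc_def)
  ultimately show "(\<lambda>z. \<Sum>k. u k z) \<in> hol_disc"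
    by (simp add: hol_disc_def)
  fix z assume z: "z \<in> \<D>"
  have "norm (\<Sum>k. u k z) \<le> (\<Sum>k. B k * norm z ^ n)"
    by (intro norm_suminf_le power_bounded_norm_le[OF u z] summable_mult2 B)
  then show "norm (\<Sum>k. u k z) \<le> suminf B * norm z ^ n"
    by (simp only: suminf_mult2[OF B])
qed

text \<open>
  Since \<open>C\<^sub>t\<close> has norm at most \<open>1 / ((n + 1) (1 - t)) < \<bar>l\<bar>\<close> on functions of order \<open>n\<close>, the Neumann
  series \<open>\<Sum>k. l\<^sup>-\<^sup>k\<^sup>-\<^sup>1 C\<^sub>t\<^sup>k h\<close> converges there. Its remainders obey the same kind of estimate, and so do
  their images under \<open>l - C\<^sub>t\<close>, whence the sum solves the equation.
\<close>
lemma shifted_Cesaro_solvable_high_order: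
  assumes t: "0 \<le> t" "t < 1" and l: "1 / ((real n + 1) * (1 - t)) < norm l"
    and h: "power_bounded n M h"
  obtains f where "power_bounded n (M / (norm l - 1 / ((real n + 1) * (1 - t)))) f"
    and "shifted l (Cesaro t) f = h"
proof -
  define \<kappa> where "\<kappa> = 1 / ((real n + 1) * (1 - t))"
  have \<kappa>: "0 \<le> \<kappa>" "\<kappa> < norm l" using t l by (auto simp: \<kappa>_def)
  then have l0: "l \<noteq> 0" by auto
  define q where "q = \<kappa> / norm l"
  have q: "0 \<le> q" "q < 1" using \<kappa> l0 by (auto simp: q_def)
  define u where "u k = ((\<lambda>f z. 1 / l * Cesaro t f z) ^^ k) (\<lambda>z. 1 / l * h z)" for k
  define B where "B k = M / norm l * q ^ k" for k
  have u_Suc: "u (Suc k) = (\<lambda>z. 1 / l * Cesaro t (u k) z)" for k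
    by (simp add: u_def)
  have u: "power_bounded n (B k) (u k)" for k
  proof (induction k)
    case 0
    then show ?case
      using power_bounded_cmult[OF h, of "1 / l"] by (simp add: u_def B_def norm_divide)
  next
    case (Suc k)
    show ?case
      using power_bounded_cmult[OF power_bounded_Cesaro[OF t Suc], of "1 / l"]
      by (simp add: u_Suc B_def q_def \<kappa>_def norm_divide mult_ac)
  qed
  have B: "summable B"
    unfolding B_def using q by (intro summable_mult summable_geometric) auto
  have B_tail: "(\<Sum>k. B (k + N)) = M / (norm l - \<kappa>) * q ^ N" for N
  proof -
    have "(\<Sum>k. B (k + N)) = (\<Sum>k. (M / norm l * q ^ N) * q ^ k)"
      by (simp add: B_def power_add mult_ac)
    also have "\<dots> = (M / norm l * q ^ N) * (1 / (1 - q))"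
      using q by (subst suminf_mult) (auto simp: suminf_geometric)
    also have "\<dots> = M / (norm l - \<kappa>) * q ^ N"
      using l0 \<kappa> by (simp add: q_def field_simps)
    finally show ?thesis .
  qed
  define f where "f z = (\<Sum>k. u k z)" for z
  have f: "power_bounded n (M / (norm l - \<kappa>)) f"
    using power_bounded_suminf[OF u B] B_tail[of 0] by (simp add: f_def[abs_def])
  define r where "r N z = (\<Sum>k. u (k + N) z)" for N z
  have r: "power_bounded n (M / (norm l - \<kappa>) * q ^ N) (r N)" for N
    using power_bounded_suminf[of n "\<lambda>k. B (k + N)" "\<lambda>k. u (k + N)", OF u] B B_tail[of N]
    by (simp add: r_def[abs_def] summable_iff_shift)
  have r_rec: "r N = (\<lambda>z. 1 * u N z + 1 * r (Suc N) z)" for N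
  proof
    fix z
    have "summable (\<lambda>k. u k z)"
    proof (cases "z \<in> \<D>")
      case True
      then show ?thesis
        by (intro summable_comparison_test'[OF B]) (rule power_bounded_imp_bound[OF u])
    next
      case False
      then show ?thesis using power_bounded_hol_disc[OF u] by (simp add: hol_disc_def)
    qed
    then have "summable (\<lambda>k. u (k + N) z)"
      by (simp add: summable_iff_shift[of "\<lambda>k. u k z"])
    from suminf_split_head[OF this]
    show "r N z = 1 * u N z + 1 * r (Suc N) z" by (simp add: r_def)
  qed
  \<comment> \<open>The series is \<open>f\<close>, with remainders \<open>r N\<close>. Applying \<open>l - C\<^sub>t\<close> to the partial sum
      \<open>f - r N\<close> telescopes to \<open>h - l * u N\<close>.\<close>
  have telescope: "shifted l (Cesaro t) f z = h z - l * u N z + shifted l (Cesaro t) (r N) z" for N z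
  proof (induction N)
    case 0
    have "r 0 = f" by (simp add: r_def[abs_def] f_def[abs_def])
    then show ?case using l0 by (simp add: u_def)
  next
    case (Suc N)
    have "shifted l (Cesaro t) (r N) z =
        shifted l (Cesaro t) (u N) z + shifted l (Cesaro t) (r (Suc N)) z"
      by (subst r_rec, subst shifted_lincomb[OF t power_bounded_hol_disc[OF u] power_bounded_hol_disc[OF r]])
        simp
    moreover have "shifted l (Cesaro t) (u N) z = l * u N z - l * u (Suc N) z"
      using l0 by (simp add: shifted_def u_Suc)
    ultimately show ?case using Suc by simp
  qed
  have "shifted l (Cesaro t) f z = h z" for z
  proof (cases "z \<in> \<D>")
    case True
    let ?D = "M + (norm l + \<kappa>) * (M / (norm l - \<kappa>))"
    have "norm (shifted l (Cesaro t) f z - h z) \<le> ?D * q ^ N" for N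
    proof -
      have "norm (l * u N z) \<le> M * q ^ N"
        using mult_left_mono[OF power_bounded_imp_bound[OF u[of N] True], of "norm l"] l0
        by (simp add: norm_mult B_def)
      moreover have "norm (shifted l (Cesaro t) (r N) z) \<le> (norm l + \<kappa>) * (M / (norm l - \<kappa>)) * q ^ N"
        using power_bounded_imp_bound[OF power_bounded_shifted[OF t r[of N], of l, folded \<kappa>_def] True]
        by (simp only: mult.assoc)
      moreover have "norm (shifted l (Cesaro t) f z - h z)
          \<le> norm (l * u N z) + norm (shifted l (Cesaro t) (r N) z)"
        unfolding telescope[of z N]
        using norm_triangle_ineq4[of "shifted l (Cesaro t) (r N) z" "l * u N z"] by (simp add: algebra_simps)
      ultimately show ?thesis by (simp only: distrib_right)
    qed
    moreover have "(\<lambda>N. ?D * q ^ N) \<longlonglongrightarrow> ?D * 0"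
      using q by (intro tendsto_intros LIMSEQ_power_zero) auto
    ultimately have "norm (shifted l (Cesaro t) f z - h z) \<le> ?D * 0"
      by (intro LIMSEQ_le_const) auto
    then show ?thesis by simp
  next
    case False
    then show ?thesis
      using power_bounded_hol_disc[OF f] power_bounded_hol_disc[OF h]
      by (simp add: shifted_def hol_disc_def Cesaro_def)
  qed
  then show thesis using that f by (auto simp: \<kappa>_def)
qed

lemma contraction_order_exists:
  assumes "(t::real) < 1" "(l::complex) \<noteq> 0"
  obtains n :: nat where "1 / ((real n + 1) * (1 - t)) < norm l"
proof -
  obtain n :: nat where n: "1 / (norm l * (1 - t)) < real n" using reals_Archimedean2 by blast
  have p: "0 < norm l * (1 - t)" using assms by simp
  have "1 < real n * (norm l * (1 - t))" using n p by (simp add: pos_divide_less_eq)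
  also have "\<dots> \<le> (real n + 1) * (norm l * (1 - t))" using p by (intro mult_right_mono) auto
  finally have "1 / ((real n + 1) * (1 - t)) < norm l"
    using assms by (subst pos_divide_less_eq) (auto simp: mult_ac)
  then show thesis by (rule that)
qed

text \<open>
  Solvability descends from order \<open>n + 1\<close> to order \<open>n\<close>: if \<open>h = r + c e\<close> with \<open>r\<close> of order \<open>n + 1\<close>
  and \<open>e\<close> the eigenfunction of order \<open>n\<close>, then adding \<open>c e / (l - 1 / (n + 1))\<close> to a solution for \<open>r\<close>
  gives a solution for \<open>h\<close>. The descent starts at an order where the Neumann series converges.
\<close>
lemma shifted_Cesaro_solvable:
  assumes t: "0 \<le> t" "t < 1" and l0: "l \<noteq> 0" and l: "\<And>m :: nat. l \<noteq> 1 / (of_nat m + 1)"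
  obtains K where "\<And>M h. 0 < M \<Longrightarrow> power_bounded 0 M h \<Longrightarrow>
    \<exists>f. power_bounded 0 (K * M) f \<and> shifted l (Cesaro t) f = h"
proof -
  define P where "P n K \<longleftrightarrow> (\<forall>M h. 0 < M \<longrightarrow> power_bounded n M h \<longrightarrow>
    (\<exists>f. power_bounded n (K * M) f \<and> shifted l (Cesaro t) f = h))" for n K
  obtain N where N: "1 / ((real N + 1) * (1 - t)) < norm l"
    using contraction_order_exists[OF t(2) l0] .
  have top: "P N (1 / (norm l - 1 / ((real N + 1) * (1 - t))))"
    unfolding P_def
  proof (intro allI impI)
    fix M h assume h: "power_bounded N M h"
    show "\<exists>f. power_bounded N (1 / (norm l - 1 / ((real N + 1) * (1 - t))) * M) f
        \<and> shifted l (Cesaro t) f = h"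
      using shifted_Cesaro_solvable_high_order[OF t N h] by (metis mult.commute times_divide_eq_right mult_1_right)
  qed
  have step: "\<exists>K. P n K" if "P (Suc n) K" for n K
  proof -
    let ?A = "3 * (2 / (1 - t)) ^ Suc n" and ?\<mu> = "l - 1 / (of_nat n + 1)"
    let ?e = "eigenfunction t n"
    have \<mu>: "?\<mu> \<noteq> 0" using l[of n] by simp
    have "P n (K * ?A + 2 ^ Suc n / norm ?\<mu> / (1 - t) ^ Suc n)"
      unfolding P_def
    proof (intro allI impI)
      fix M h assume M: "(0::real) < M" and h: "power_bounded n M h"
      obtain c where c: "norm c \<le> 2 ^ Suc n * M"
        and r: "power_bounded (Suc n) (?A * M) (\<lambda>z. h z - c * ?e z)"
        using power_bounded_split[OF t M h] .
      have "0 < ?A * M" using M t by simp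
      then obtain g where g: "power_bounded (Suc n) (K * (?A * M)) g"
        and eq: "shifted l (Cesaro t) g = (\<lambda>z. h z - c * ?e z)"
        using \<open>P (Suc n) K\<close> r unfolding P_def by blast
      let ?f = "\<lambda>z. 1 * g z + c / ?\<mu> * ?e z"
      have "power_bounded n (norm (1::complex) * (K * (?A * M)) + norm (c / ?\<mu>) * (1 / (1 - t) ^ Suc n)) ?f"
        by (rule power_bounded_lincomb[OF power_bounded_lower_order[OF g] power_bounded_eigenfunction[OF t]])
      moreover have "norm (c / ?\<mu>) * (1 / (1 - t) ^ Suc n) \<le> (2 ^ Suc n * M / norm ?\<mu>) * (1 / (1 - t) ^ Suc n)"
        unfolding norm_divide using c t \<mu> by (intro mult_right_mono divide_right_mono) auto
      ultimately have "power_bounded n ((K * ?A + 2 ^ Suc n / norm ?\<mu> / (1 - t) ^ Suc n) * M) ?f"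
        by (elim power_bounded_mono) (simp add: ring_distribs mult_ac)
      moreover have "shifted l (Cesaro t) ?f = h"
        unfolding shifted_lincomb[OF t power_bounded_hol_disc[OF g] eigenfunction_hol_disc[OF t]]
          shifted_eigenfunction[OF t] eq
        using \<mu> by simp
      ultimately show "\<exists>f. power_bounded n ((K * ?A + 2 ^ Suc n / norm ?\<mu> / (1 - t) ^ Suc n) * M) f
          \<and> shifted l (Cesaro t) f = h" by blast
    qed
    then show ?thesis by blast
  qed
  have "\<exists>K. P 0 K"
    by (rule inc_induct[of 0 N "\<lambda>n. \<exists>K. P n K"]) (use top step in auto)
  then show thesis using that unfolding P_def by blast
qed

section \<open>Injectivity of the shifted operator\<close>

lemma Cesaro_injective:
  assumes t: "0 \<le> t" "t < 1" and f: "f \<in> hol_disc" and 0: "Cesaro t f = (\<lambda>_. 0)"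
  shows "f = (\<lambda>_. 0)"
proof
  fix z
  obtain G where G: "G 0 = 0"
    "\<And>z. z \<in> \<D> \<Longrightarrow> (G has_field_derivative f z / (1 - complex_of_real t * z)) (at z)"
    "\<And>z. z \<in> \<D> \<Longrightarrow> Cesaro t f z = (if z = 0 then f 0 else G z / z)"
    using Cesaro_primitive[OF t f] by blast
  have G0: "G w = 0" if "w \<in> \<D>" for w
    using G(1) G(3)[OF that] 0 by (auto split: if_splits)
  show "f z = 0"
  proof (cases "z \<in> \<D>")
    case True
    have "((\<lambda>_. 0) has_field_derivative f z / (1 - complex_of_real t * z)) (at z)"
      by (rule has_field_derivative_transform_within_open[OF G(2)[OF True] open_ball True G0])
    then have "f z / (1 - complex_of_real t * z) = 0"
      by (rule DERIV_unique) simp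
    then show ?thesis using one_minus_mult_nonzero[OF t, of z] True by simp
  qed (use f in \<open>simp add: hol_disc_def\<close>)
qed

text \<open>
  If \<open>f\<close> is in the kernel and has order \<open>n\<close>, subtract its component \<open>c e\<close> along the eigenfunction.
  Then \<open>l - C\<^sub>t\<close> maps the difference, which has order \<open>n + 1\<close>, to \<open>- c (l - 1 / (n + 1)) e\<close>, which
  has order exactly \<open>n\<close> unless \<open>c = 0\<close>. Hence \<open>f\<close> has every order, in particular one at which
  \<open>C\<^sub>t / l\<close> is a strict contraction; being fixed by it, \<open>f\<close> vanishes.
\<close>
lemma shifted_Cesaro_kernel_trivial:
  assumes t: "0 \<le> t" "t < 1" and l: "\<And>m :: nat. l \<noteq> 1 / (of_nat m + 1)"
    and f: "f \<in> Hinf" and eig: "shifted l (Cesaro t) f = (\<lambda>_. 0)"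
  shows "f = (\<lambda>_. 0)"
proof (cases "l = 0")
  case True
  have "Cesaro t f = (\<lambda>_. 0)"
    using eig True by (simp add: shifted_def fun_eq_iff)
  then show ?thesis using Cesaro_injective[OF t] f by (simp add: Hinf_def)
next
  case False
  have all_orders: "\<exists>M>0. power_bounded n M f" for n
  proof (induction n)
    case 0
    have "power_bounded 0 (norm_inf f + 1) f"
      by (rule power_bounded_0_of_Hinf[OF f]) simp
    then show ?case using norm_inf_nonneg[OF f] by (intro exI[of _ "norm_inf f + 1"]) simp
  next
    case (Suc n)
    then obtain M where M: "0 < M" "power_bounded n M f" by blast
    let ?e = "eigenfunction t n" and ?\<mu> = "l - 1 / (of_nat n + 1)"
    obtain c K where r: "power_bounded (Suc n) K (\<lambda>z. f z - c * ?e z)"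
      using power_bounded_split[OF t M] by metis
    have "shifted l (Cesaro t) (\<lambda>z. 1 * f z + (- c) * ?e z) = (\<lambda>z. (- c * ?\<mu>) * ?e z)"
      unfolding shifted_lincomb[OF t power_bounded_hol_disc[OF M(2)] eigenfunction_hol_disc[OF t]]
        shifted_eigenfunction[OF t] eig by (simp add: algebra_simps)
    then have "power_bounded (Suc n) ((norm l + 1 / ((real (Suc n) + 1) * (1 - t))) * K)
        (\<lambda>z. (- c * ?\<mu>) * ?e z)"
      using power_bounded_shifted[OF t r, of l] by simp
    from eigenfunction_exact_order[OF t this] have "c = 0" using l[of n] by simp
    then have "power_bounded (Suc n) K f" using r by simp
    then have "power_bounded (Suc n) (\<bar>K\<bar> + 1) f" by (rule power_bounded_mono) simp
    then show ?case by (intro exI[of _ "\<bar>K\<bar> + 1"]) auto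
  qed
  obtain n where n: "1 / ((real n + 1) * (1 - t)) < norm l"
    using contraction_order_exists[OF t(2) False] .
  obtain M where M: "power_bounded n M f" using all_orders by blast
  define q where "q = 1 / ((real n + 1) * (1 - t)) / norm l"
  have q: "0 \<le> q" "q < 1"
    using n t False divide_less_eq_1_pos[of "norm l"] by (simp_all add: q_def del: divide_divide_eq_left divide_less_eq_1_pos)
  have f_eq: "f = (\<lambda>z. 1 / l * Cesaro t f z)"
    using eig False by (simp add: shifted_def fun_eq_iff field_simps)
  have iter: "power_bounded n (M * q ^ k) f" for k
  proof (induction k)
    case (Suc k)
    show ?case
      using power_bounded_cmult[OF power_bounded_Cesaro[OF t Suc], of "1 / l"]
      unfolding f_eq[symmetric] by (simp add: q_def norm_divide mult_ac)
  qed (use M in simp)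
  show ?thesis
  proof
    fix z
    show "f z = 0"
    proof (cases "z \<in> \<D>")
      case True
      have "(\<lambda>k. M * q ^ k) \<longlonglongrightarrow> M * 0"
        using q by (intro tendsto_intros LIMSEQ_power_zero) auto
      then have "norm (f z) \<le> M * 0"
        by (rule LIMSEQ_le_const) (use power_bounded_imp_bound[OF iter True] in blast)
      then show ?thesis by simp
    qed (use f in \<open>simp add: Hinf_def hol_disc_def\<close>)
  qed
qed

section \<open>The spectra\<close>

text \<open>
  The primitive in the definition of \<open>C\<^sub>t\<close> has a bounded derivative, hence is Lipschitz and extends
  continuously to the closed disc. Away from the origin one divides by \<open>z\<close>, and near the origin
  \<open>C\<^sub>t f\<close> is holomorphic; the extension is glued from these two descriptions.
\<close>
lemma Cesaro_Hinf_disc_algebra: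
  assumes t: "0 \<le> t" "t < 1" and f: "f \<in> Hinf"
  shows "Cesaro t f \<in> disc_algebra"
proof -
  have fh: "f \<in> hol_disc" using f by (simp add: Hinf_def)
  obtain G where G: "G 0 = 0"
    "\<And>z. z \<in> \<D> \<Longrightarrow> (G has_field_derivative f z / (1 - complex_of_real t * z)) (at z)"
    "\<And>z. z \<in> \<D> \<Longrightarrow> Cesaro t f z = (if z = 0 then f 0 else G z / z)"
    using Cesaro_primitive[OF t fh] by blast
  have "norm (G w - G z) \<le> norm_inf f / (1 - t) * norm (w - z)" if "z \<in> \<D>" "w \<in> \<D>" for w z
    by (rule field_differentiable_bound[OF convex_ball[of 0 1] has_field_derivative_at_within[OF G(2)]
          Cesaro_integrand_bound[OF t f]]) (use that in auto)
  then have "(norm_inf f / (1 - t))-lipschitz_on \<D> G"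
    using norm_inf_nonneg[OF f] t by (intro lipschitz_onI) (auto simp: dist_norm)
  then obtain H where H: "uniformly_continuous_on (closure \<D>) H" "\<And>z. z \<in> \<D> \<Longrightarrow> G z = H z"
    using uniformly_continuous_on_extension_on_closure lipschitz_on_uniformly_continuous by metis
  define h where "h z = (if z \<in> \<D> then Cesaro t f z else H z / z)" for z
  have CH: "Cesaro t f \<in> hol_disc" by (rule Cesaro_hol_disc[OF t fh])
  have "continuous_on (cball 0 (1/2) \<union> (closure \<D> - ball 0 (1/2))) h"
  proof (rule continuous_on_closed_Un)
    have "continuous_on (cball 0 (1/2)) (Cesaro t f)"
      using CH by (auto simp: hol_disc_def intro!: holomorphic_on_imp_continuous_on
          elim: holomorphic_on_subset)
    then show "continuous_on (cball 0 (1/2)) h"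
      by (rule continuous_on_eq) (auto simp: h_def)
    have "continuous_on (closure \<D> - ball 0 (1/2)) (\<lambda>z. H z / z)"
      using uniformly_continuous_imp_continuous[OF H(1)]
      by (intro continuous_intros) (auto elim: continuous_on_subset)
    then show "continuous_on (closure \<D> - ball 0 (1/2)) h"
      by (rule continuous_on_eq) (auto simp: h_def G(3) H(2))
  qed auto
  moreover have "cball 0 (1/2) \<union> (closure \<D> - ball 0 (1/2)) = closure \<D>"
    by auto
  ultimately have "continuous_on (closure \<D>) h" by simp
  then show ?thesis
    using CH unfolding disc_algebra_def by (auto simp: h_def intro!: exI[of _ h])
qed

text \<open>
  The inclusions are what is needed on either side: the eigenfunctions lie in the smaller space, the
  injectivity of \<open>l - C\<^sub>t\<close> holds on the larger one, and solutions found in \<open>H\<^sup>\<infinity>\<close> lie in \<open>X\<close> again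
  because \<open>C\<^sub>t\<close> maps \<open>H\<^sup>\<infinity>\<close> into the disc algebra.
\<close>
lemma spectra_Cesaro_intermediate:
  assumes t: "0 \<le> t" "t < 1"
    and X: "disc_algebra \<subseteq> X" "X \<subseteq> Hinf"
    and X_lincomb: "\<And>f g a b. f \<in> X \<Longrightarrow> g \<in> X \<Longrightarrow> (\<lambda>z. a * f z + b * g z) \<in> X"
  shows "point_spectrum_on X (Cesaro t) = {1 / (of_nat m + 1) | m :: nat. True}"
    and "spectrum_on X (Cesaro t) = {1 / (of_nat m + 1) | m :: nat. True} \<union> {0}"
proof -
  let ?\<Lambda> = "{1 / (of_nat m + 1) | m :: nat. True} :: complex set"
  have Xh: "f \<in> hol_disc" if "f \<in> X" for f using that X(2) by (auto simp: Hinf_def)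
  have eX: "eigenfunction t n \<in> X" for n using eigenfunction_disc_algebra[OF t] X(1) by blast
  have shifted_zero: "shifted l (Cesaro t) (\<lambda>_. 0) = (\<lambda>_. 0)" for l
    using shifted_lincomb[OF t eigenfunction_hol_disc[OF t] eigenfunction_hol_disc[OF t], of l 0 _ 0] by simp
  have zX: "(\<lambda>_. 0) \<in> X" using X_lincomb[OF eX eX, of 0 _ 0] by simp
  have inj: "inj_on (shifted l (Cesaro t)) X" if "l \<notin> ?\<Lambda>" for l
  proof (rule inj_onI)
    fix f g assume fg: "f \<in> X" "g \<in> X" and eq: "shifted l (Cesaro t) f = shifted l (Cesaro t) g"
    have "(\<lambda>z. 1 * f z + (- 1) * g z) \<in> Hinf" using X_lincomb fg X(2) by blast
    moreover have "shifted l (Cesaro t) (\<lambda>z. 1 * f z + (- 1) * g z) = (\<lambda>_. 0)"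
      unfolding shifted_lincomb[OF t Xh[OF fg(1)] Xh[OF fg(2)]] eq by simp
    ultimately have "(\<lambda>z. 1 * f z + (- 1) * g z) = (\<lambda>_. 0)"
      by (rule shifted_Cesaro_kernel_trivial[OF t, of l, rotated]) (use that in auto)
    then show "f = g" by (simp add: fun_eq_iff)
  qed
  have not_inj: "\<not> inj_on (shifted l (Cesaro t)) X" if "l \<in> ?\<Lambda>" for l
  proof
    assume inj: "inj_on (shifted l (Cesaro t)) X"
    obtain n :: nat where n: "l = 1 / (of_nat n + 1)" using \<open>l \<in> ?\<Lambda>\<close> by blast
    have "shifted l (Cesaro t) (eigenfunction t n) = shifted l (Cesaro t) (\<lambda>_. 0)"
      by (simp add: shifted_eigenfunction[OF t] shifted_zero n)
    then show False
      using inj_onD[OF inj _ eX zX] eigenfunction_nonzero[OF t] by blast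
  qed
  show "point_spectrum_on X (Cesaro t) = ?\<Lambda>"
    unfolding point_spectrum_on_def using inj not_inj by blast
  have "l \<in> spectrum_on X (Cesaro t)" if "l \<in> ?\<Lambda>" for l
  proof -
    have False if "\<forall>f\<in>X. S (shifted l (Cesaro t) f) = f" for S
      using not_inj[OF \<open>l \<in> ?\<Lambda>\<close>] that by (metis inj_on_inverseI)
    then show ?thesis by (auto simp: spectrum_on_def)
  qed
  moreover have "0 \<in> spectrum_on X (Cesaro t)"
  proof (rule ccontr)
    assume "0 \<notin> spectrum_on X (Cesaro t)"
    then obtain S where S: "bounded_operator_on X S" and inv: "\<And>f. f \<in> X \<Longrightarrow> S (shifted 0 (Cesaro t) f) = f"
      by (auto simp: spectrum_on_def)
    obtain K where K: "\<And>f. f \<in> X \<Longrightarrow> norm_inf (S f) \<le> K * norm_inf f"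
      using S unfolding bounded_operator_on_def by blast
    \<comment> \<open>The inverse multiplies the \<open>n\<close>-th eigenfunction by \<open>n + 1\<close>; the sign comes from
        \<^term>\<open>shifted 0 (Cesaro t)\<close> being \<open>- C\<^sub>t\<close>.\<close>
    have "real n + 1 \<le> K" for n
    proof -
      let ?e = "eigenfunction t n" and ?c = "- (of_nat n + 1 :: complex)"
      have nz: "complex_of_nat n + 1 \<noteq> 0" by (metis of_nat_Suc of_nat_eq_0_iff Suc_not_Zero add.commute)
      have e': "(\<lambda>z. ?c * ?e z + 0 * ?e z) \<in> X" by (rule X_lincomb[OF eX eX])
      have "shifted 0 (Cesaro t) (\<lambda>z. ?c * ?e z + 0 * ?e z) = ?e"
        unfolding shifted_lincomb[OF t Xh[OF eX] Xh[OF eX]] shifted_eigenfunction[OF t]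
        using nz by (simp add: fun_eq_iff) (simp add: field_simps)
      then have "S ?e = (\<lambda>z. ?c * ?e z)" using inv[OF e'] by simp
      then have "norm ?c \<le> K"
        using K[OF eX[of n]] eX[of n] X(2) eigenfunction_nonzero[OF t]
        by (intro norm_eigenvalue_le[of ?e]) auto
      then show ?thesis by (metis norm_minus_cancel norm_of_nat of_nat_Suc add.commute)
    qed
    moreover obtain n :: nat where "K < real n" using reals_Archimedean2 by blast
    ultimately show False by (smt (verit))
  qed
  moreover have "l \<notin> spectrum_on X (Cesaro t)" if l: "l \<notin> ?\<Lambda>" "l \<noteq> 0" for l
  proof -
    obtain K where K: "\<And>M h. 0 < M \<Longrightarrow> power_bounded 0 M h \<Longrightarrow>
        \<exists>f. power_bounded 0 (K * M) f \<and> shifted l (Cesaro t) f = h"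
      using shifted_Cesaro_solvable[OF t l(2)] l(1) by blast
    have solve: "\<exists>f\<in>X. shifted l (Cesaro t) f = h \<and> norm_inf f \<le> K * norm_inf h" if h: "h \<in> X" for h
    proof (cases "norm_inf h = 0")
      case True
      then have "h = (\<lambda>_. 0)" using norm_inf_eq_0_imp[of h] h X(2) by blast
      moreover have "norm_inf (\<lambda>_. 0) = 0" by (simp add: norm_inf_def)
      ultimately show ?thesis using zX shifted_zero by (intro bexI[of _ "\<lambda>_. 0"]) auto
    next
      case False
      have hH: "h \<in> Hinf" using h X(2) by blast
      then have "0 < norm_inf h" using norm_inf_nonneg[OF hH] False by simp
      then obtain f where f: "power_bounded 0 (K * norm_inf h) f" and eq: "shifted l (Cesaro t) f = h"
        using K power_bounded_0_of_Hinf[OF hH order_refl] by blast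
      \<comment> \<open>The equation \<open>l f = h + C\<^sub>t f\<close> carries the regularity of \<open>h\<close> over to \<open>f\<close>.\<close>
      have "f = (\<lambda>z. 1 / l * h z + 1 / l * Cesaro t f z)"
        using eq[symmetric] l(2) by (simp add: shifted_def fun_eq_iff field_simps)
      moreover have "(\<lambda>z. 1 / l * h z + 1 / l * Cesaro t f z) \<in> X"
        using h Cesaro_Hinf_disc_algebra[OF t power_bounded_imp_Hinf[OF f]] X(1) by (intro X_lincomb) auto
      ultimately have "f \<in> X" by simp
      moreover have "norm_inf f \<le> K * norm_inf h"
        unfolding norm_inf_def[of f]
        using power_bounded_imp_bound[OF f] by (intro cSUP_least) auto
      ultimately show ?thesis using eq by blast
    qed
    define S where "S h = (SOME f. f \<in> X \<and> shifted l (Cesaro t) f = h \<and> norm_inf f \<le> K * norm_inf h)" for h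
    have S: "S h \<in> X" "shifted l (Cesaro t) (S h) = h" "norm_inf (S h) \<le> K * norm_inf h" if "h \<in> X" for h
      using someI_ex[of "\<lambda>f. f \<in> X \<and> shifted l (Cesaro t) f = h \<and> norm_inf f \<le> K * norm_inf h"]
        solve[OF that] unfolding S_def by blast+
    note injD = inj_onD[OF inj[OF l(1)]]
    have CX: "Cesaro t f \<in> X" if "f \<in> X" for f
      using that X Cesaro_Hinf_disc_algebra[OF t] by blast
    have shX: "shifted l (Cesaro t) f \<in> X" if "f \<in> X" for f
      using X_lincomb[OF that CX[OF that], of l "-1"] by (simp add: shifted_def)
    have "bounded_operator_on X S"
      unfolding bounded_operator_on_def
    proof (intro conjI ballI allI exI)
      fix f g a b assume fg: "f \<in> X" "g \<in> X"
      note comb = X_lincomb[OF fg] X_lincomb[OF S(1)[OF fg(1)] S(1)[OF fg(2)]]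
      have "shifted l (Cesaro t) (\<lambda>z. a * S f z + b * S g z) = (\<lambda>z. a * f z + b * g z)"
        unfolding shifted_lincomb[OF t Xh[OF S(1)[OF fg(1)]] Xh[OF S(1)[OF fg(2)]]]
          S(2)[OF fg(1)] S(2)[OF fg(2)] ..
      then show "S (\<lambda>z. a * f z + b * g z) = (\<lambda>z. a * S f z + b * S g z)"
        by (intro injD[OF _ S(1)[OF comb(1)] comb(2)]) (simp only: S(2)[OF comb(1)])
    qed (use S in auto)
    moreover have "S (shifted l (Cesaro t) f) = f" if "f \<in> X" for f
      by (rule injD[OF S(2)[OF shX[OF that]] S(1)[OF shX[OF that]] that])
    ultimately show ?thesis using S(2) by (auto simp: spectrum_on_def)
  qed
  ultimately show "spectrum_on X (Cesaro t) = ?\<Lambda> \<union> {0}" by blast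
qed

theorem proposition2p3:
  fixes t :: real
  assumes "0 \<le> t" and "t < 1"
  shows "point_spectrum_on Hinf (Cesaro t) = {1 / (of_nat m + 1) | m :: nat. True} \<and>
    point_spectrum_on disc_algebra (Cesaro t) = {1 / (of_nat m + 1) | m :: nat. True} \<and>
    spectrum_on Hinf (Cesaro t) = {1 / (of_nat m + 1) | m :: nat. True} \<union> {0} \<and>
    spectrum_on disc_algebra (Cesaro t) = {1 / (of_nat m + 1) | m :: nat. True} \<union> {0}"
proof (intro conjI)
  note spectra_Hinf = spectra_Cesaro_intermediate[OF assms disc_algebra_subset_Hinf order_refl Hinf_lincomb]
  show "point_spectrum_on Hinf (Cesaro t) = {1 / (of_nat m + 1) | m :: nat. True}"
    by (rule spectra_Hinf(1))
  show "spectrum_on Hinf (Cesaro t) = {1 / (of_nat m + 1) | m :: nat. True} \<union> {0}"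
    by (rule spectra_Hinf(2))
  note spectra_disc_algebra =
    spectra_Cesaro_intermediate[OF assms order_refl disc_algebra_subset_Hinf disc_algebra_lincomb]
  show "point_spectrum_on disc_algebra (Cesaro t) = {1 / (of_nat m + 1) | m :: nat. True}"
    by (rule spectra_disc_algebra(1))
  show "spectrum_on disc_algebra (Cesaro t) = {1 / (of_nat m + 1) | m :: nat. True} \<union> {0}"
    by (rule spectra_disc_algebra(2))
qed

end
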